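(* Assume that the reflexive Banach space $\mathscr{Y}$ is compactly embedded into $\mathscr{X}$, and let $z\in L^2(0,T;\mathscr{Y})$. Let the transformation operators $\mathcal{T}_1,\ldots,\mathcal{T}_r$ satisfy: (A1) For every $i=1,\ldots,r$, every $\varphi_i\in\mathscr{Y}$ and every $p_i\in\mathbb{R}$, $\mathcal{T}_i(p_i)\mathscr{Y}\subseteq\mathscr{Y}$, and the mapping $\mathbb{R}\to\mathscr{X}$, $p_i\mapsto\mathcal{T}_i(p_i)\varphi_i$, is continuous. (A2) For every $i=1,\ldots,r$, every $\alpha_i\in L^2(0,T)$, every $p_i\in H^1(0,T)$ and every $\varphi_i\in\mathscr{Y}$, one has $\alpha_i\mathcal{T}_i(p_i)\varphi_i\in L^2(0,T;\mathscr{X})$. Let $C>0$ and let $\Lambda_C\colon\mathscr{Z}\to\mathbb{R}$ be a penalty functional satisfying the penalty assumption (stated in the context). Let $(\lambda^k)_{k\in\mathbb{N}}\subseteq\mathbb{R}$ be a non-decreasing sequence of positive numbers with $\lim_{k\to\infty}\lambda^k=\infty$. For each $k\in\mathbb{N}$ let $(\boldsymbol{\alpha}^k,\boldsymbol{p}^k,\boldsymbol{\varphi}^k)\in\mathscr{Z}$ be a solution of the unconstrained problem $$\min_{(\boldsymbol{\alpha},\boldsymbol{p},\boldsymbol{\varphi})\in\mathscr{Z}}\Big(J(\boldsymbol{\alpha},\boldsymbol{p},\boldsymbol{\varphi})+\lambda^k\Lambda_C(\boldsymbol{\alpha},\boldsymbol{p},\boldsymbol{\varphi})\Big).$$ Then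 any limit point of $(\boldsymbol{\alpha}^k,\boldsymbol{p}^k,\boldsymbol{\varphi}^k)_{k\in\mathbb{N}}$ (i.e. the limit of any subsequence converging in $\mathscr{Z}$) is a solution of the constrained problem $$\min_{(\boldsymbol{\alpha},\boldsymbol{p},\boldsymbol{\varphi})}J(\boldsymbol{\alpha},\boldsymbol{p},\boldsymbol{\varphi})\quad\text{subject to}\quad(\boldsymbol{\alpha},\boldsymbol{p},\boldsymbol{\varphi})\in\mathcal{A}_C.$$
   Context: Let $T>0$ and $r\in\mathbb{N}$. Let $(\mathscr{X},\langle\cdot,\cdot\rangle_{\mathscr{X}})$ be a real Hilbert space with induced norm $\|\cdot\|_{\mathscr{X}}$, and let $\mathscr{Y}$ be a dense subspace of $\mathscr{X}$ that is itself a reflexive Banach space with norm $\|\cdot\|_{\mathscr{Y}}$. Let $\mathscr{B}(\mathscr{X})$ be the bounded linear operators on $\mathscr{X}$. For $i=1,\ldots,r$ let $\mathcal{T}_i\colon\mathbb{R}\to\mathscr{B}(\mathscr{X})$ be a family of bounded linear operators (no linearity in the parameter is assumed). For $\alpha_i\in L^2(0,T)$, $p_i\in H^1(0,T)$, $\varphi_i\in\mathscr{Y}$, the expression $\alpha_i\mathcal{T}_i(p_i)\varphi_i$ denotes the function $t\mapsto\alpha_i(t)\,\mathcal{T}_i(p_i(t))\varphi_i$. $L^2(0,T;\mathscr{X})$ denotes the Bochner space. Set $$\mathscr{Z}:=L^2(0,T;\mathbb{R}^r)\times H^1(0,T;\mathbb{R}^r)\times\mathscr{Y}^r,$$ with elements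 $(\boldsymbol{\alpha},\boldsymbol{p},\boldsymbol{\varphi})$, where $\boldsymbol{\alpha}=(\alpha_1,\ldots,\alpha_r)$, $\boldsymbol{p}=(p_1,\ldots,p_r)$, $\boldsymbol{\varphi}=(\varphi_1,\ldots,\varphi_r)$. The cost functional is $$J\colon\mathscr{Z}\to\mathbb{R},\qquad J(\boldsymbol{\alpha},\boldsymbol{p},\boldsymbol{\varphi})=\frac12\left\|z-\sum_{i=1}^r\alpha_i\mathcal{T}_i(p_i)\varphi_i\right\|_{L^2(0,T;\mathscr{X})}^2,$$ and for $C>0$ the admissible set $\mathcal{A}_C$ consists of all $(\boldsymbol{\alpha},\boldsymbol{p},\boldsymbol{\varphi})\in\mathscr{Z}$ with $\max\{\|\varphi_i\|_{\mathscr{Y}},\|\alpha_i\|_{L^2(0,T)},\|p_i\|_{H^1(0,T)}\}\le C$ for all $i=1,\ldots,r$. Penalty assumption: the functional $\Lambda_C\colon\mathscr{Z}\to\mathbb{R}$ is continuous, weakly sequentially lower semicontinuous, non-negative, and satisfies: - $\Lambda_C(\boldsymbol{\alpha},\boldsymbol{p},\boldsymbol{\varphi})=0$ if and only if $(\boldsymbol{\alpha},\boldsymbol{p},\boldsymbol{\varphi})\in\mathcal{A}_C$; - for any sequence $(\boldsymbol{\alpha}^k,\boldsymbol{p}^k,\boldsymbol{\varphi}^k)$ in $\mathscr{Z}$ with $\max\{\|\boldsymbol{\alpha}^k\|_{L^2(0,T;\mathbb{R}^r)},\|\boldsymbol{p}^k\|_{H^1(0,T;\mathbb{R}^r)},\|\boldsymbol{\varphi}^k\|_{\mathscr{Y}^r}\}\to\infty$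 for $k\to\infty$, one has $\Lambda_C(\boldsymbol{\alpha}^k,\boldsymbol{p}^k,\boldsymbol{\varphi}^k)\to\infty$ for $k\to\infty$. *)

theory Defs
  imports "HOL-Analysis.Analysis"
begin

text \<open>
  Elements of the Bochner space \<open>L\<^sup>2(0,T;E)\<close> are given by representatives, functions
  on \<open>\<real>\<close> of which only the values on \<open>{0<..<T}\<close> matter. Nothing below distinguishes functions
  that agree almost everywhere there: a functional that is continuous for the seminorms
  (see \<open>continuous_on_Z\<close>) takes the same value at any two points at distance zero, so it is a
  functional on the space of equivalence classes.

  Measurability is strong measurability (an a.e. limit of simple functions). This avoids the
  assumption \<open>second_countable_topology\<close> that the library's Bochner integral makes on the
  value space.
\<close>

abbreviation interval_measure :: "real \<Rightarrow> real measure" where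
  "interval_measure T \<equiv> lebesgue_on {0<..<T}"

definition strongly_measurable :: "'a measure \<Rightarrow> ('a \<Rightarrow> 'b::real_normed_vector) \<Rightarrow> bool" where
  "strongly_measurable M f \<longleftrightarrow>
     (\<exists>s :: nat \<Rightarrow> 'a \<Rightarrow> 'b. (\<forall>n. simple_function M (s n)) \<and>
        (AE t in M. (\<lambda>n. s n t) \<longlonglongrightarrow> f t))"

definition L2 :: "real \<Rightarrow> (real \<Rightarrow> 'b::real_normed_vector) set" where
  "L2 T = {f. strongly_measurable (interval_measure T) f \<and>
              integrable (interval_measure T) (\<lambda>t. (norm (f t))\<^sup>2)}"

definition norm_L2 :: "real \<Rightarrow> (real \<Rightarrow> 'b::real_normed_vector) \<Rightarrow> real" where
  "norm_L2 T f = sqrt (LINT t|interval_measure T. (norm (f t))\<^sup>2)"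

definition test_functions :: "real \<Rightarrow> (real \<Rightarrow> real) set" where
  "test_functions T = {\<eta>. (\<forall>n x. ((deriv ^^ n) \<eta>) differentiable (at x)) \<and>
                          closure {x. \<eta> x \<noteq> 0} \<subseteq> {0<..<T}}"

definition is_weak_deriv ::
  "real \<Rightarrow> (real \<Rightarrow> 'b::{banach, second_countable_topology}) \<Rightarrow> (real \<Rightarrow> 'b) \<Rightarrow> bool" where
  "is_weak_deriv T p g \<longleftrightarrow>
     (\<forall>\<eta>\<in>test_functions T.
        (LINT t|interval_measure T. deriv \<eta> t *\<^sub>R p t) =
        - (LINT t|interval_measure T. \<eta> t *\<^sub>R g t))"

definition H1 :: "real \<Rightarrow> (real \<Rightarrow> 'b::{banach, second_countable_topology}) set" where
  "H1 T = {p \<in> L2 T. \<exists>g \<in> L2 T. is_weak_deriv T p g}"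

text \<open>The weak derivative is determined up to equality almost everywhere.\<close>

definition weak_deriv ::
  "real \<Rightarrow> (real \<Rightarrow> 'b::{banach, second_countable_topology}) \<Rightarrow> (real \<Rightarrow> 'b)" where
  "weak_deriv T p = (SOME g. g \<in> L2 T \<and> is_weak_deriv T p g)"

definition norm_H1 :: "real \<Rightarrow> (real \<Rightarrow> 'b::{banach, second_countable_topology}) \<Rightarrow> real" where
  "norm_H1 T p = sqrt ((norm_L2 T p)\<^sup>2 + (norm_L2 T (weak_deriv T p))\<^sup>2)"

definition reflexive_space :: "'y::banach itself \<Rightarrow> bool" where
  "reflexive_space _ \<longleftrightarrow>
     (\<forall>\<Phi> :: ('y \<Rightarrow>\<^sub>L real) \<Rightarrow>\<^sub>L real. \<exists>y. \<forall>f. blinfun_apply \<Phi> f = blinfun_apply f y)"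

text \<open>
  A subspace of \<open>'x\<close> carrying its own norm is represented by a normed space \<open>'y\<close> together with
  the (injective, linear) inclusion map \<open>\<iota>\<close>.
\<close>

definition compact_embedding :: "('y::real_normed_vector \<Rightarrow> 'x::real_normed_vector) \<Rightarrow> bool" where
  "compact_embedding \<iota> \<longleftrightarrow> bounded_linear \<iota> \<and> inj \<iota> \<and>
     (\<forall>B. bounded B \<longrightarrow> compact (closure (\<iota> ` B)))"

type_synonym ('r, 'y) control = "(real \<Rightarrow> real ^ 'r) \<times> (real \<Rightarrow> real ^ 'r) \<times> ('y ^ 'r)"

definition Z :: "real \<Rightarrow> ('r::finite, 'y::real_normed_vector) control set" where
  "Z T = {(\<alpha>, p, \<phi>). \<alpha> \<in> L2 T \<and> p \<in> H1 T}"

fun add_Z :: "('r::finite, 'y::real_normed_vector) control \<Rightarrow> ('r, 'y) control \<Rightarrow> ('r, 'y) control"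
  where
  "add_Z (\<alpha>, p, \<phi>) (\<beta>, q, \<psi>) = ((\<lambda>t. \<alpha> t + \<beta> t), (\<lambda>t. p t + q t), \<phi> + \<psi>)"

fun scale_Z :: "real \<Rightarrow> ('r::finite, 'y::real_normed_vector) control \<Rightarrow> ('r, 'y) control" where
  "scale_Z c (\<alpha>, p, \<phi>) = ((\<lambda>t. c *\<^sub>R \<alpha> t), (\<lambda>t. c *\<^sub>R p t), c *\<^sub>R \<phi>)"

fun norm_Z :: "real \<Rightarrow> ('r::finite, 'y::real_normed_vector) control \<Rightarrow> real" where
  "norm_Z T (\<alpha>, p, \<phi>) = sqrt ((norm_L2 T \<alpha>)\<^sup>2 + (norm_H1 T p)\<^sup>2 + (norm \<phi>)\<^sup>2)"

definition dist_Z ::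
  "real \<Rightarrow> ('r::finite, 'y::real_normed_vector) control \<Rightarrow> ('r, 'y) control \<Rightarrow> real" where
  "dist_Z T u v = norm_Z T (add_Z u (scale_Z (- 1) v))"

definition dual_Z :: "real \<Rightarrow> (('r::finite, 'y::real_normed_vector) control \<Rightarrow> real) set" where
  "dual_Z T = {l. (\<forall>u\<in>Z T. \<forall>v\<in>Z T. l (add_Z u v) = l u + l v) \<and>
                  (\<forall>c. \<forall>u\<in>Z T. l (scale_Z c u) = c * l u) \<and>
                  (\<exists>K. \<forall>u\<in>Z T. \<bar>l u\<bar> \<le> K * norm_Z T u)}"

definition continuous_on_Z ::
  "real \<Rightarrow> (('r::finite, 'y::real_normed_vector) control \<Rightarrow> real) \<Rightarrow> bool" where
  "continuous_on_Z T F \<longleftrightarrow>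
     (\<forall>u\<in>Z T. \<forall>e>0. \<exists>d>0. \<forall>v\<in>Z T. dist_Z T v u < d \<longrightarrow> \<bar>F v - F u\<bar> < e)"

definition weakly_seq_lsc_on_Z ::
  "real \<Rightarrow> (('r::finite, 'y::real_normed_vector) control \<Rightarrow> real) \<Rightarrow> bool" where
  "weakly_seq_lsc_on_Z T F \<longleftrightarrow>
     (\<forall>w u. (\<forall>k. w k \<in> Z T) \<longrightarrow> u \<in> Z T \<longrightarrow>
        (\<forall>l\<in>dual_Z T. (\<lambda>k. l (w k)) \<longlonglongrightarrow> l u) \<longrightarrow>
        ereal (F u) \<le> liminf (\<lambda>k. ereal (F (w k))))"

definition admissible :: "real \<Rightarrow> real \<Rightarrow> ('r::finite, 'y::real_normed_vector) control set" where
  "admissible T C = {(\<alpha>, p, \<phi>). (\<alpha>, p, \<phi>) \<in> Z T \<and>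
     (\<forall>i. Max {norm (\<phi> $ i), norm_L2 T (\<lambda>t. \<alpha> t $ i), norm_H1 T (\<lambda>t. p t $ i)} \<le> C)}"

fun cost ::
  "real \<Rightarrow> ('y::real_normed_vector \<Rightarrow> 'x::real_normed_vector) \<Rightarrow>
   ('r::finite \<Rightarrow> real \<Rightarrow> 'x \<Rightarrow>\<^sub>L 'x) \<Rightarrow> (real \<Rightarrow> 'x) \<Rightarrow> ('r, 'y) control \<Rightarrow> real" where
  "cost T \<iota> \<T> z (\<alpha>, p, \<phi>) =
     (1 / 2) * (norm_L2 T (\<lambda>t. z t -
        (\<Sum>i\<in>UNIV. \<alpha> t $ i *\<^sub>R blinfun_apply (\<T> i (p t $ i)) (\<iota> (\<phi> $ i)))))\<^sup>2"

definition penalty_functional ::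
  "real \<Rightarrow> real \<Rightarrow> (('r::finite, 'y::real_normed_vector) control \<Rightarrow> real) \<Rightarrow> bool" where
  "penalty_functional T C \<Lambda> \<longleftrightarrow>
     continuous_on_Z T \<Lambda> \<and>
     weakly_seq_lsc_on_Z T \<Lambda> \<and>
     (\<forall>u\<in>Z T. 0 \<le> \<Lambda> u) \<and>
     (\<forall>u\<in>Z T. \<Lambda> u = 0 \<longleftrightarrow> u \<in> admissible T C) \<and>
     (\<forall>\<alpha> p \<phi>. (\<forall>k :: nat. (\<alpha> k, p k, \<phi> k) \<in> Z T) \<longrightarrow>
        filterlim (\<lambda>k. Max {norm_L2 T (\<alpha> k), norm_H1 T (p k), norm (\<phi> k)}) at_top sequentially \<longrightarrow>
        filterlim (\<lambda>k. \<Lambda> (\<alpha> k, p k, \<phi> k)) at_top sequentially)"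

end

theory Submission
  imports Defs "HOL-Real_Asymp.Real_Asymp"
begin

text \<open>
  The zero control is admissible, so minimality bounds \<open>lam k * \<Lambda> (w k)\<close> by the cost of zero.
  Hence \<open>\<Lambda> (w k)\<close> tends to 0 and, by continuity, \<open>\<Lambda>\<close> vanishes at the limit point, which is
  therefore admissible. Minimality also bounds the cost of \<open>w k\<close> by that of any admissible
  control, and the bound passes to the limit point because the cost is lower semicontinuous along
  strongly convergent sequences.

  That zero is admissible is not immediate: \<open>norm_H1\<close> uses a weak derivative picked by \<open>SOME\<close>,
  and only the fundamental lemma of the calculus of variations shows that every weak derivative of
  zero vanishes almost everywhere.
\<close>

subsection \<open>Smooth bump functions\<close>

text \<open>For \<open>P = 1\<close> this is the classical smooth function that is flat at the
  origin. Admitting a polynomial in \<open>1 / x\<close> makes the family closed under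
  differentiation.\<close>

definition flat_at_0 :: "real poly \<Rightarrow> real \<Rightarrow> real" where
  "flat_at_0 P x = (if x > 0 then poly P (1 / x) * exp (- (1 / x)) else 0)"

lemma poly_times_exp_minus_tendsto_0:
  "((\<lambda>y::real. poly P y * exp (- y)) \<longlongrightarrow> 0) at_top"
proof -
  have "((\<lambda>y::real. \<Sum>i\<le>degree P. coeff P i * (y ^ i / exp y)) \<longlongrightarrow> (\<Sum>i\<le>degree P. coeff P i * 0)) at_top"
    by (intro tendsto_sum tendsto_mult tendsto_const tendsto_power_div_exp_0)
  then show ?thesis
    by (simp add: poly_altdef sum_distrib_right exp_minus divide_inverse mult.assoc)
qed

text \<open>In terms of \<open>y = 1 / x\<close>, differentiating \<open>1 / x\<close> produces the
  factor \<open>y\<^sup>2\<close> up to sign, which is the polynomial \<open>[:0, 0, 1:]\<close>. At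
  the origin the exponential decay beats every polynomial in \<open>y\<close>.\<close>

lemma flat_at_0_has_derivative:
  "(flat_at_0 P has_real_derivative flat_at_0 ([:0, 0, 1:] * (P - pderiv P)) x) (at x)"
proof -
  consider "x > 0" | "x < 0" | "x = 0" by linarith
  then show ?thesis
  proof cases
    case 1
    have "((\<lambda>y. poly P (1 / y) * exp (- (1 / y))) has_real_derivative
        poly (pderiv P) (1 / x) * (- (1 / x\<^sup>2)) * exp (- (1 / x))
          + exp (- (1 / x)) * (1 / x\<^sup>2) * poly P (1 / x)) (at x)"
      using 1 by (auto intro!: derivative_eq_intros simp: power2_eq_square)
    moreover have "poly (pderiv P) (1 / x) * (- (1 / x\<^sup>2)) * exp (- (1 / x))
          + exp (- (1 / x)) * (1 / x\<^sup>2) * poly P (1 / x)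
        = flat_at_0 ([:0, 0, 1:] * (P - pderiv P)) x"
      using 1 by (simp add: flat_at_0_def field_simps power2_eq_square)
    ultimately have "((\<lambda>y. poly P (1 / y) * exp (- (1 / y))) has_real_derivative
        flat_at_0 ([:0, 0, 1:] * (P - pderiv P)) x) (at x)"
      by (simp only:)
    then show ?thesis
      by (rule has_field_derivative_transform_within_open[of _ _ _ "{0<..}"])
         (use 1 in \<open>simp_all add: flat_at_0_def\<close>)
  next
    case 2
    have "((\<lambda>_. 0) has_real_derivative flat_at_0 ([:0, 0, 1:] * (P - pderiv P)) x) (at x)"
      using 2 by (simp add: flat_at_0_def)
    then show ?thesis
      by (rule has_field_derivative_transform_within_open[of _ _ _ "{..<0}"])
         (use 2 in \<open>simp_all add: flat_at_0_def\<close>)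
  next
    case 3
    have "((\<lambda>h. flat_at_0 P h / h) \<longlongrightarrow> 0) (at_right 0)"
    proof -
      \<comment> \<open>The extra factor \<open>[:0, 1:]\<close> absorbs the division by
        \<open>h\<close> in the difference quotient.\<close>
      have "((\<lambda>h::real. poly ([:0, 1:] * P) (inverse h) * exp (- inverse h)) \<longlongrightarrow> 0) (at_right 0)"
        by (rule filterlim_compose[OF poly_times_exp_minus_tendsto_0 filterlim_inverse_at_top_right])
      moreover have "\<forall>\<^sub>F h in at_right 0. poly ([:0, 1:] * P) (inverse h) * exp (- inverse h) = flat_at_0 P h / h"
        by (intro eventually_at_rightI[of 0 1]) (auto simp: flat_at_0_def field_simps)
      ultimately show ?thesis by (rule Lim_transform_eventually)
    qed
    moreover have "((\<lambda>h. flat_at_0 P h / h) \<longlongrightarrow> 0) (at_left 0)"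
      by (rule tendsto_eventually, intro eventually_at_leftI[of "-1"]) (auto simp: flat_at_0_def)
    ultimately have "((\<lambda>h. flat_at_0 P h / h) \<longlongrightarrow> 0) (at 0)"
      by (simp add: filterlim_split_at)
    then show ?thesis
      using 3 by (simp add: has_field_derivative_iff flat_at_0_def)
  qed
qed

text \<open>Closure under differentiation gives smoothness by induction, with no formula for higher
  derivatives: \<open>cmult\<close> takes up the chain rule factor, \<open>add\<close> and
  \<open>mult\<close> the product rule. Affine arguments allow for the reflected right cutoff of a
  bump.\<close>

inductive_set flat_algebra :: "(real \<Rightarrow> real) set" where
  base: "(\<lambda>x. flat_at_0 P (c * x + d)) \<in> flat_algebra"
| cmult: "f \<in> flat_algebra \<Longrightarrow> (\<lambda>x. c * f x) \<in> flat_algebra"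
| add: "f \<in> flat_algebra \<Longrightarrow> g \<in> flat_algebra \<Longrightarrow> (\<lambda>x. f x + g x) \<in> flat_algebra"
| mult: "f \<in> flat_algebra \<Longrightarrow> g \<in> flat_algebra \<Longrightarrow> (\<lambda>x. f x * g x) \<in> flat_algebra"

lemma flat_algebra_has_derivative:
  assumes "f \<in> flat_algebra"
  shows "\<exists>g\<in>flat_algebra. \<forall>x. (f has_real_derivative g x) (at x)"
  using assms
proof induction
  case (base P c d)
  let ?Q = "[:0, 0, 1:] * (P - pderiv P)"
  have "((\<lambda>x. flat_at_0 P (c * x + d)) has_real_derivative c * flat_at_0 ?Q (c * x + d)) (at x)" for x
    by (rule DERIV_cong[OF DERIV_chain2[OF flat_at_0_has_derivative, of _ c]])
       (auto intro!: derivative_eq_intros)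
  then show ?case
    using flat_algebra.cmult[OF flat_algebra.base] by fast
next
  case (cmult f c)
  then obtain f' where "f' \<in> flat_algebra" "\<And>x. (f has_real_derivative f' x) (at x)" by blast
  then show ?case
    by (intro bexI[of _ "\<lambda>x. c * f' x"]) (auto intro: DERIV_cmult flat_algebra.cmult)
next
  case (add f g)
  then obtain f' g' where "f' \<in> flat_algebra" "\<And>x. (f has_real_derivative f' x) (at x)"
     "g' \<in> flat_algebra" "\<And>x. (g has_real_derivative g' x) (at x)" by blast
  then show ?case
    by (intro bexI[of _ "\<lambda>x. f' x + g' x"]) (auto intro: DERIV_add flat_algebra.add)
next
  case (mult f g)
  then obtain f' g' where "f' \<in> flat_algebra" "\<And>x. (f has_real_derivative f' x) (at x)"
     "g' \<in> flat_algebra" "\<And>x. (g has_real_derivative g' x) (at x)" by blast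
  with mult.hyps show ?case
    by (intro bexI[of _ "\<lambda>x. f' x * g x + g' x * f x"])
       (auto intro: DERIV_mult flat_algebra.add flat_algebra.mult)
qed

lemma flat_algebra_higher_deriv:
  assumes "f \<in> flat_algebra"
  shows "(deriv ^^ n) f \<in> flat_algebra"
proof (induction n)
  case (Suc n)
  then obtain g where "g \<in> flat_algebra" "\<forall>x. ((deriv ^^ n) f has_real_derivative g x) (at x)"
    using flat_algebra_has_derivative by blast
  moreover from this have "deriv ((deriv ^^ n) f) = g"
    by (auto intro: DERIV_imp_deriv)
  ultimately show ?case by simp
qed (simp add: assms)

lemma flat_algebra_higher_differentiable:
  assumes "f \<in> flat_algebra"
  shows "(deriv ^^ n) f differentiable (at x)"
  using flat_algebra_has_derivative[OF flat_algebra_higher_deriv[OF assms]] real_differentiable_def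
  by blast

text \<open>The shift by 1 keeps the support inside \<open>{a + 1 / Suc n..b - 1 / Suc n}\<close>.\<close>

definition bump :: "real \<Rightarrow> real \<Rightarrow> nat \<Rightarrow> real \<Rightarrow> real" where
  "bump a b n x = flat_at_0 1 (real (Suc n) * (x - a) - 1) * flat_at_0 1 (real (Suc n) * (b - x) - 1)"

lemma bump_test_function:
  assumes "0 \<le> a" "b \<le> T"
  shows "bump a b n \<in> test_functions T"
proof -
  have "bump a b n = (\<lambda>x. flat_at_0 1 (real (Suc n) * x + (- (real (Suc n) * a) - 1)) *
      flat_at_0 1 (- real (Suc n) * x + (real (Suc n) * b - 1)))"
    by (auto simp: bump_def algebra_simps)
  then have "bump a b n \<in> flat_algebra"
    by (metis flat_algebra.mult flat_algebra.base)
  moreover have "closure {x. bump a b n x \<noteq> 0} \<subseteq> {a + 1 / Suc n..b - 1 / Suc n}"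
    by (rule closure_minimal) (auto simp: bump_def flat_at_0_def field_simps split: if_splits)
  moreover have "{a + 1 / Suc n..b - 1 / Suc n} \<subseteq> {0<..<T}"
  proof
    fix x assume "x \<in> {a + 1 / Suc n..b - 1 / Suc n}"
    \<comment> \<open>This strict gap keeps the closed interval inside the open one even when
      \<open>a = 0\<close> or \<open>b = T\<close>.\<close>
    moreover have "1 / real (Suc n) > 0" by simp
    ultimately show "x \<in> {0<..<T}" using assms unfolding atLeastAtMost_iff greaterThanLessThan_iff by linarith
  qed
  ultimately show ?thesis
    using flat_algebra_higher_differentiable by (fastforce simp: test_functions_def)
qed

lemma bump_bounds: "0 \<le> bump a b n x" "bump a b n x \<le> 1"
  by (auto simp: bump_def flat_at_0_def intro!: mult_le_one)

text \<open>The argument tends to infinity, where \<open>exp (- (1 / y))\<close> tends to 1, and it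
  is eventually positive.\<close>

lemma flat_at_0_1_tendsto_1:
  assumes "c > 0"
  shows "(\<lambda>n. flat_at_0 1 (real (Suc n) * c - 1)) \<longlonglongrightarrow> 1"
proof -
  have lim: "filterlim (\<lambda>n. real (Suc n) * c - 1) at_top sequentially"
    using assms by real_asymp
  have "((\<lambda>y::real. exp (- (1 / y))) \<longlongrightarrow> 1) at_top"
    by real_asymp
  from filterlim_compose[OF this lim] have "(\<lambda>n. exp (- (1 / (real (Suc n) * c - 1)))) \<longlonglongrightarrow> 1" .
  moreover have "\<forall>\<^sub>F n in sequentially. exp (- (1 / (real (Suc n) * c - 1))) = flat_at_0 1 (real (Suc n) * c - 1)"
    using filterlim_at_top_dense[THEN iffD1, OF lim, rule_format, of 0]
    by eventually_elim (simp add: flat_at_0_def)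
  ultimately show ?thesis by (rule Lim_transform_eventually)
qed

lemma bump_tendsto_indicator:
  "(\<lambda>n. bump a b n x) \<longlonglongrightarrow> indicator {a<..<b} x"
proof (cases "a < x \<and> x < b")
  case True
  then have "(\<lambda>n. bump a b n x) \<longlonglongrightarrow> 1 * 1"
    unfolding bump_def by (intro tendsto_mult flat_at_0_1_tendsto_1) auto
  with True show ?thesis by simp
next
  case False
  have "bump a b n x = 0" for n
  proof -
    \<comment> \<open>At such a point one of the two arguments of \<open>flat_at_0\<close> is at
      most -1, so that factor vanishes for every \<open>n\<close>. The case \<open>b \<le> a\<close>
      is included.\<close>
    have "real (Suc n) * (x - a) \<le> 0 \<or> real (Suc n) * (b - x) \<le> 0"
      using False by (auto simp: mult_le_0_iff simp del: of_nat_Suc)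
    then show ?thesis
      unfolding bump_def flat_at_0_def by (auto simp del: of_nat_Suc)
  qed
  with False show ?thesis by simp
qed

lemma test_function_continuous:
  assumes "\<eta> \<in> test_functions T"
  shows "continuous_on A \<eta>" "continuous_on A (deriv \<eta>)"
proof -
  have "\<eta> differentiable (at x)" "deriv \<eta> differentiable (at x)" for x
    using assms by (auto simp: test_functions_def dest: spec[of _ 0] spec[of _ "Suc 0"])
  then show "continuous_on A \<eta>" "continuous_on A (deriv \<eta>)"
    by (meson continuous_at_imp_continuous_on differentiable_imp_continuous_within)+
qed

lemma continuous_imp_measurable_lebesgue_on:
  fixes f :: "real \<Rightarrow> 'b::topological_space"
  assumes "continuous_on UNIV f"
  shows "f \<in> borel_measurable (lebesgue_on S)"
  using borel_measurable_continuous_onI[OF assms]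
  by (intro measurable_restrict_space1 measurable_completion) simp

subsection \<open>The fundamental lemma of the calculus of variations\<close>

text \<open>Borel set induction extends the vanishing of the integral from closed intervals to all
  Borel sets, and an integrable density is determined almost everywhere by its integrals. The
  complement step needs the integral over the whole line, which \<open>outside\<close> reduces to
  that over one interval.\<close>

lemma AE_eq_0_if_interval_integrals_eq_0:
  fixes H :: "real \<Rightarrow> real"
  assumes int: "integrable lborel H"
    and zero: "\<And>a b. (LINT t:{a..b}|lborel. H t) = 0"
    and outside: "AE t in lborel. t \<notin> {c..d} \<longrightarrow> H t = 0"
  shows "AE t in lborel. H t = 0"
proof -
  have [measurable]: "H \<in> borel_measurable borel"
    using int by auto
  have set_int: "set_integrable lborel A H" if "A \<in> sets borel" for A
    using set_integrable_subset[of lborel UNIV H A] int that by (simp add: set_integrable_def)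
  have total: "(LINT t:UNIV|lborel. H t) = 0"
  proof -
    have "(LINT t:UNIV|lborel. H t) = (LINT t:{c..d}|lborel. H t)"
      unfolding set_lebesgue_integral_def
      by (rule integral_cong_AE) (use outside in \<open>auto simp: indicator_def\<close>)
    then show ?thesis using zero by simp
  qed
  have "(LINT t:A|lborel. H t) = 0" if "A \<in> sets borel" for A
    using that
  proof (induction A rule: borel_set_induct)
    case empty
    then show ?case by (simp add: set_lebesgue_integral_def)
  next
    case (interval a b)
    show ?case by (rule zero)
  next
    case (compl A)
    have "(LINT t:UNIV|lborel. H t) = (LINT t:A \<union> -A|lborel. H t)" by simp
    also have "\<dots> = (LINT t:A|lborel. H t) + (LINT t:-A|lborel. H t)"
      using compl by (intro set_integral_Un set_int) auto
    finally show ?case using total compl by simp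
  next
    case (union f)
    then have "(LINT t:(\<Union>i. f i)|lborel. H t) = (\<Sum>i. LINT t:f i|lborel. H t)"
      by (intro lebesgue_integral_countable_add set_int)
         (auto simp: disjoint_family_on_def)
    then show ?case using union by simp
  qed
  then show ?thesis
    by (intro density_unique_real[OF int]) auto
qed

text \<open>Bumps increase the stock of zero integrals to open intervals by dominated convergence.
  The rest transfers the claim from Lebesgue measure on the interval to Borel measure on the line,
  where the previous lemma applies.\<close>

lemma AE_eq_0_if_test_integrals_eq_0:
  fixes h :: "real \<Rightarrow> real"
  assumes int: "integrable (interval_measure T) h"
    and zero: "\<And>\<eta>. \<eta> \<in> test_functions T \<Longrightarrow> (LINT t|interval_measure T. \<eta> t * h t) = 0"
  shows "AE t in interval_measure T. h t = 0"
proof -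
  let ?M = "interval_measure T"
  have [measurable]: "h \<in> borel_measurable ?M" using int by auto
  have interval: "(LINT t|?M. indicator {a<..<b} t * h t) = 0" if "0 \<le> a" "b \<le> T" for a b
  proof -
    have "(\<lambda>n. LINT t|?M. bump a b n t * h t) \<longlonglongrightarrow> (LINT t|?M. indicator {a<..<b} t * h t)"
    proof (rule integral_dominated_convergence)
      show "(\<lambda>t. indicator {a<..<b} t * h t) \<in> borel_measurable ?M"
        by (rule borel_measurable_times[OF measurable_restrict_space1[OF measurable_completion]]) auto
      show "(\<lambda>t. bump a b n t * h t) \<in> borel_measurable ?M" for n
        using test_function_continuous(1)[OF bump_test_function[OF that]]
        by (rule borel_measurable_times[OF continuous_imp_measurable_lebesgue_on]) auto
      show "integrable ?M (\<lambda>t. \<bar>h t\<bar>)" using int by (rule integrable_abs)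
      show "AE t in ?M. (\<lambda>n. bump a b n t * h t) \<longlonglongrightarrow> indicator {a<..<b} t * h t"
        by (intro AE_I2 tendsto_mult bump_tendsto_indicator tendsto_const)
      show "AE t in ?M. norm (bump a b n t * h t) \<le> \<bar>h t\<bar>" for n
        using bump_bounds[of a b n] by (auto simp: abs_mult mult_left_le_one_le)
    qed
    moreover have "(LINT t|?M. bump a b n t * h t) = 0" for n
      by (intro zero bump_test_function that)
    ultimately show ?thesis by (simp add: LIMSEQ_const_iff)
  qed
  \<comment> \<open>Extension by zero to the line, followed by the choice of a Borel representative
    \<open>H'\<close>.\<close>
  define H where "H = (\<lambda>t. indicator {0<..<T} t * h t)"
  have H_int: "integrable lebesgue H"
    using int unfolding H_def by (subst (asm) integrable_restrict_space) auto
  then obtain H' where H'[measurable]: "H' \<in> borel_measurable lborel" and AE_H': "AE t in lborel. H t = H' t"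
    using completion_ex_borel_measurable_real by blast
  have AE_leb: "AE t in lebesgue. H t = H' t"
    using AE_H' by (simp add: AE_completion_iff)
  have H'_int: "integrable lborel H'"
  proof -
    have "integrable lebesgue H'"
      by (rule integrable_cong_AE_imp[OF H_int]) (use AE_leb measurable_completion[OF H'] in simp_all)
    then show ?thesis by (simp add: integrable_completion)
  qed
  have "AE t in lborel. H' t = 0"
  proof (rule AE_eq_0_if_interval_integrals_eq_0[OF H'_int])
    show "AE t in lborel. t \<notin> {0..T} \<longrightarrow> H' t = 0"
      using AE_H' by eventually_elim (auto simp: H_def)
    fix a b :: real
    \<comment> \<open>Truncation meets the conditions of \<open>interval\<close>. Where
      \<open>H\<close> is nonzero, \<open>{a..b}\<close> and \<open>?I\<close> can differ only at
      \<open>a\<close> and \<open>b\<close>, which are null sets.\<close>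
    let ?I = "{max a 0<..<min b T}"
    have "(LINT t:{a..b}|lborel. H' t) = (LINT t|lborel. indicator ?I t * H' t)"
      unfolding set_lebesgue_integral_def
    proof (rule integral_cong_AE)
      show "AE t in lborel. indicator {a..b} t *\<^sub>R H' t = indicator ?I t * H' t"
        using AE_H' AE_lborel_singleton[of a] AE_lborel_singleton[of b]
        by eventually_elim (auto simp: H_def indicator_def split: if_splits)
    qed auto
    also have "\<dots> = (LINT t|lebesgue. indicator ?I t * H' t)"
      by (rule integral_completion[symmetric]) auto
    also have "\<dots> = (LINT t|lebesgue. indicator {0<..<T} t *\<^sub>R (indicator ?I t * h t))"
    proof (rule integral_cong_AE)
      show "AE t in lebesgue. indicator ?I t * H' t = indicator {0<..<T} t *\<^sub>R (indicator ?I t * h t)"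
        using AE_leb by eventually_elim (auto simp: H_def indicator_def)
      have "(\<lambda>t. indicator ?I t * H t) \<in> borel_measurable lebesgue"
        by (rule borel_measurable_times[OF measurable_completion borel_measurable_integrable[OF H_int]]) auto
      then show "(\<lambda>t. indicator {0<..<T} t *\<^sub>R (indicator ?I t * h t)) \<in> borel_measurable lebesgue"
        by (simp add: H_def mult_ac)
      show "(\<lambda>t. indicator ?I t * H' t) \<in> borel_measurable lebesgue"
        by (rule measurable_completion) auto
    qed
    also have "\<dots> = (LINT t|?M. indicator ?I t * h t)"
      by (subst integral_restrict_space) auto
    finally show "(LINT t:{a..b}|lborel. H' t) = 0"
      using interval by simp
  qed
  with AE_H' have "AE t in lborel. H t = 0" by eventually_elim simp
  then have "AE t in lebesgue. H t = 0" by (simp add: AE_completion_iff)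
  then show ?thesis
    by (subst AE_restrict_space_iff) (auto simp: H_def)
qed

subsection \<open>Pointwise convergent sequences of operators\<close>

text \<open>By Baire's theorem one of the sets \<open>F n\<close> contains a ball. Subtracting its
  centre gives a uniform bound near zero, and scaling extends it to the whole space.\<close>

lemma banach_steinhaus:
  fixes A :: "'i \<Rightarrow> 'a::banach \<Rightarrow> 'b::real_normed_vector"
  assumes lin: "\<And>i. bounded_linear (A i)"
    and bdd: "\<And>y. \<exists>K. \<forall>i. norm (A i y) \<le> K"
  obtains K where "\<And>i y. norm (A i y) \<le> K * norm y"
proof -
  define F where "F n = {y. \<forall>i. norm (A i y) \<le> real n}" for n
  have closed: "closed (F n)" for n
    unfolding F_def
    by (intro closed_Collect_all closed_Collect_le continuous_intros
        linear_continuous_on_compose[OF continuous_on_id] bounded_linear.linear lin)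
       (rule bounded_linear.continuous_on[OF lin continuous_on_id])
  have "(\<Union>n. F n) = UNIV"
  proof safe
    fix y
    obtain K where "\<And>i. norm (A i y) \<le> K" using bdd by blast
    moreover obtain n where "K \<le> real n" using real_arch_simple by blast
    ultimately show "y \<in> (\<Union>n. F n)" unfolding F_def by (auto intro: order_trans)
  qed auto
  \<comment> \<open>Closed sets without interior points would have a union without interior points,
    but this union is the whole space.\<close>
  moreover have "euclidean interior_of (\<Union>n. F n) = {}" if "\<And>n. interior (F n) = {}"
    using that closed completely_metrizable_space_euclidean
    by (intro Baire_category_alt) auto
  ultimately obtain n where "interior (F n) \<noteq> {}" by fastforce
  then obtain a e where e: "e > 0" "ball a e \<subseteq> F n"
    by (metis all_not_in_conv mem_interior)
  have small: "norm (A i y) \<le> 2 * real n" if "norm y < e" for i y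
  proof -
    have "a + y \<in> F n" "a \<in> F n"
      using e that by (auto simp: dist_norm subset_iff)
    then have "norm (A i (a + y)) \<le> real n" "norm (A i a) \<le> real n"
      by (auto simp: F_def)
    moreover have "A i y = A i (a + y) - A i a"
      by (simp add: lin linear_simps)
    ultimately show ?thesis
      by (smt (verit) norm_triangle_ineq4)
  qed
  show ?thesis
  proof
    fix i y
    show "norm (A i y) \<le> (4 * real n / e) * norm y"
    proof (cases "y = 0")
      case True
      then show ?thesis by (simp add: lin linear_simps)
    next
      case False
      \<comment> \<open>Rescaling to norm \<open>e / 2\<close> stays strictly inside the ball of
        radius \<open>e\<close>; this turns \<open>2 * real n\<close> into the constant
        \<open>4 * real n / e\<close>.\<close>
      then have "norm (A i ((e / (2 * norm y)) *\<^sub>R y)) \<le> 2 * real n"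
        using e(1) by (intro small) simp
      moreover have "norm (A i ((e / (2 * norm y)) *\<^sub>R y)) = e / (2 * norm y) * norm (A i y)"
        using e(1) by (simp add: lin linear_simps)
      ultimately have "e / (2 * norm y) * norm (A i y) \<le> 2 * real n" by (simp only:)
      then show ?thesis using e(1) False by (simp add: field_simps)
    qed
  qed
qed

text \<open>Split \<open>A k (x k)\<close> into \<open>A k (x k - y) + A k y\<close>. The uniform
  bound from Banach-Steinhaus makes the first summand vanish in the limit.\<close>

lemma tendsto_pointwise_convergent_operators:
  fixes A :: "nat \<Rightarrow> 'a::banach \<Rightarrow> 'b::real_normed_vector"
  assumes lin: "\<And>k. bounded_linear (A k)"
    and lim: "\<And>y. (\<lambda>k. A k y) \<longlonglongrightarrow> B y"
    and x: "x \<longlonglongrightarrow> y"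
  shows "(\<lambda>k. A k (x k)) \<longlonglongrightarrow> B y"
proof -
  have "\<exists>K. \<forall>k. norm (A k y) \<le> K" for y
    using convergent_imp_Bseq[OF convergentI[OF lim]] by (auto simp: Bseq_def)
  from banach_steinhaus[OF lin this] obtain K where K: "\<And>k y. norm (A k y) \<le> K * norm y"
    by blast
  have "(\<lambda>k. K * norm (x k - y)) \<longlonglongrightarrow> 0"
    by (intro tendsto_mult_right_zero tendsto_norm_zero LIM_zero x)
  then have "(\<lambda>k. A k (x k - y)) \<longlonglongrightarrow> 0"
    by (rule Lim_null_comparison[OF always_eventually, rotated]) (simp add: K)
  from tendsto_add[OF this lim[of y]] show ?thesis
    by (simp add: lin linear_simps)
qed

subsection \<open>The spaces \<open>L2\<close> and \<open>H1\<close>\<close>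

lemma complete_measure_lebesgue_on:
  assumes "S \<in> sets lebesgue"
  shows "complete_measure (lebesgue_on S)"
proof
  fix A B assume "B \<subseteq> A" "A \<in> null_sets (lebesgue_on S)"
  then have "B \<subseteq> S" "B \<in> sets lebesgue"
    using assms completion.complete by (auto simp: null_sets_restrict_space)
  then show "B \<in> sets (lebesgue_on S)"
    using assms by (simp add: sets_restrict_space_iff)
qed

text \<open>Overwriting all functions by one constant on a null set turns the limit into an
  everywhere limit. Completeness then permits preimages to be changed by a null set.\<close>

lemma (in complete_measure) borel_measurable_AE_LIMSEQ:
  fixes f :: "nat \<Rightarrow> 'a \<Rightarrow> 'b::metric_space"
  assumes f: "\<And>n. f n \<in> borel_measurable M"
    and lim: "AE x in M. (\<lambda>n. f n x) \<longlonglongrightarrow> g x"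
  shows "g \<in> borel_measurable M"
proof -
  obtain N where N: "N \<in> null_sets M" "{x \<in> space M. \<not> (\<lambda>n. f n x) \<longlonglongrightarrow> g x} \<subseteq> N"
    using lim unfolding eventually_ae_filter by auto
  define g' where "g' = (\<lambda>x. if x \<in> N then undefined else g x)"
  have meas: "g' \<in> borel_measurable M"
  proof (rule borel_measurable_LIMSEQ_metric)
    show "(\<lambda>x. if x \<in> N then undefined else f n x) \<in> borel_measurable M" for n
      using f N(1) by (intro measurable_If_set) auto
    show "(\<lambda>n. if x \<in> N then undefined else f n x) \<longlonglongrightarrow> g' x" if "x \<in> space M" for x
      using that N(2) by (auto simp: g'_def)
  qed
  have ae: "AE x in M. x \<in> g' -` A \<inter> space M \<longleftrightarrow> x \<in> g -` A \<inter> space M" for A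
    using AE_not_in[OF N(1)] by eventually_elim (simp add: g'_def)
  have "g -` A \<inter> space M \<in> sets M" if "A \<in> sets borel" for A
    by (rule in_sets_AE[OF ae measurable_sets[OF meas that]]) simp
  then show ?thesis by (intro measurableI) auto
qed

lemma strongly_measurable_imp_borel_measurable:
  assumes "strongly_measurable (interval_measure T) f"
  shows "f \<in> borel_measurable (interval_measure T)"
proof -
  obtain s where "\<And>n. simple_function (interval_measure T) (s n)"
    and "AE t in interval_measure T. (\<lambda>n. s n t) \<longlonglongrightarrow> f t"
    using assms unfolding strongly_measurable_def by blast
  with complete_measure.borel_measurable_AE_LIMSEQ[OF complete_measure_lebesgue_on, of _ s f]
  show ?thesis
    by (simp add: borel_measurable_simple_function)
qed

text \<open>Working with simple approximants, rather than with Borel sets of a product, avoids any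
  separability of the value spaces.\<close>

lemma strongly_measurable_compose2:
  assumes f: "strongly_measurable M f" and g: "strongly_measurable M g"
    and cont: "\<And>x y X Y. X \<longlonglongrightarrow> x \<Longrightarrow> Y \<longlonglongrightarrow> y \<Longrightarrow> (\<lambda>n. h (X n) (Y n)) \<longlonglongrightarrow> h x y"
  shows "strongly_measurable M (\<lambda>t. h (f t) (g t))"
proof -
  obtain X Y where X: "\<And>n. simple_function M (X n)" "AE t in M. (\<lambda>n. X n t) \<longlonglongrightarrow> f t"
    and Y: "\<And>n. simple_function M (Y n)" "AE t in M. (\<lambda>n. Y n t) \<longlonglongrightarrow> g t"
    using f g unfolding strongly_measurable_def by blast
  have "AE t in M. (\<lambda>n. h (X n t) (Y n t)) \<longlonglongrightarrow> h (f t) (g t)"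
    using X(2) Y(2) by eventually_elim (rule cont)
  moreover have "simple_function M (\<lambda>t. h (X n t) (Y n t))" for n
    by (rule simple_function_compose2[OF X(1) Y(1)])
  ultimately show ?thesis
    unfolding strongly_measurable_def by (intro exI[of _ "\<lambda>n t. h (X n t) (Y n t)"]) simp
qed

section \<open>Linear operations and integrability in \<open>L2\<close>\<close>

lemma L2_add:
  assumes "f \<in> L2 T" "g \<in> L2 T"
  shows "(\<lambda>t. f t + g t) \<in> L2 T"
proof -
  have meas: "strongly_measurable (interval_measure T) (\<lambda>t. f t + g t)"
    by (rule strongly_measurable_compose2[where h = "(+)"])
       (use assms in \<open>simp_all add: L2_def tendsto_add\<close>)
  have "integrable (interval_measure T) (\<lambda>t. (norm (f t + g t))\<^sup>2)"
  proof (rule Bochner_Integration.integrable_bound)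
    show "integrable (interval_measure T) (\<lambda>t. 2 * (norm (f t))\<^sup>2 + 2 * (norm (g t))\<^sup>2)"
      using assms by (auto simp: L2_def)
    show "(\<lambda>t. (norm (f t + g t))\<^sup>2) \<in> borel_measurable (interval_measure T)"
      using strongly_measurable_imp_borel_measurable[OF meas] by measurable
    have "(norm (x + y))\<^sup>2 \<le> 2 * (norm x)\<^sup>2 + 2 * (norm y)\<^sup>2" for x y :: 'a
    proof -
      have "(norm (x + y))\<^sup>2 \<le> (norm x + norm y)\<^sup>2"
        by (intro power_mono norm_triangle_ineq) auto
      also have "\<dots> \<le> 2 * (norm x)\<^sup>2 + 2 * (norm y)\<^sup>2"
        using zero_le_power2[of "norm x - norm y"] by (simp add: power2_eq_square algebra_simps)
      finally show ?thesis .
    qed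
    then show "AE t in interval_measure T. norm ((norm (f t + g t))\<^sup>2)
        \<le> norm (2 * (norm (f t))\<^sup>2 + 2 * (norm (g t))\<^sup>2)"
      by simp
  qed
  with meas show ?thesis by (simp add: L2_def)
qed

lemma L2_bounded_linear:
  assumes "bounded_linear h" "f \<in> L2 T"
  shows "(\<lambda>t. h (f t)) \<in> L2 T"
proof -
  \<comment> \<open>The unary map is treated as a binary operation that ignores its second
    argument.\<close>
  have meas: "strongly_measurable (interval_measure T) (\<lambda>t. h (f t))"
    by (rule strongly_measurable_compose2[where h = "\<lambda>x _. h x" and g = f])
       (use assms in \<open>simp_all add: L2_def bounded_linear.tendsto\<close>)
  obtain K where K: "\<And>x. norm (h x) \<le> norm x * K"
    using bounded_linear.bounded[OF assms(1)] by blast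
  have "integrable (interval_measure T) (\<lambda>t. (norm (h (f t)))\<^sup>2)"
  proof (rule Bochner_Integration.integrable_bound)
    show "integrable (interval_measure T) (\<lambda>t. K\<^sup>2 * (norm (f t))\<^sup>2)"
      using assms by (auto simp: L2_def)
    show "(\<lambda>t. (norm (h (f t)))\<^sup>2) \<in> borel_measurable (interval_measure T)"
      using strongly_measurable_imp_borel_measurable[OF meas] by measurable
    have "(norm (h x))\<^sup>2 \<le> K\<^sup>2 * (norm x)\<^sup>2" for x
      using power_mono[OF K norm_ge_zero, of x 2] by (simp add: power_mult_distrib mult.commute)
    then show "AE t in interval_measure T. norm ((norm (h (f t)))\<^sup>2) \<le> norm (K\<^sup>2 * (norm (f t))\<^sup>2)"
      by simp
  qed
  with meas show ?thesis by (simp add: L2_def)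
qed

lemma L2_zero: "(\<lambda>_. 0) \<in> L2 T"
  by (auto simp: L2_def strongly_measurable_def intro!: exI[of _ "\<lambda>_ _. 0"])

lemma L2_diff:
  assumes "f \<in> L2 T" "g \<in> L2 T"
  shows "(\<lambda>t. f t - g t) \<in> L2 T"
  using L2_add[OF assms(1) L2_bounded_linear[OF bounded_linear_minus[OF bounded_linear_ident] assms(2)]]
  by simp

lemma L2_sum:
  assumes "finite I" "\<And>i. i \<in> I \<Longrightarrow> f i \<in> L2 T"
  shows "(\<lambda>t. \<Sum>i\<in>I. f i t) \<in> L2 T"
  using assms by (induction I rule: finite_induct) (auto simp: L2_zero L2_add)

lemma norm_L2_nonneg: "0 \<le> norm_L2 T f"
  by (simp add: norm_L2_def)

lemma norm_L2_squared: "(norm_L2 T f)\<^sup>2 = (LINT t|interval_measure T. (norm (f t))\<^sup>2)"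
  by (simp add: norm_L2_def)

lemma finite_measure_interval: "finite_measure (interval_measure T)"
  by (rule finite_measure_lebesgue_on) simp

text \<open>The bound \<open>x \<le> 1 + x\<^sup>2\<close> suffices because the interval has finite
  measure.\<close>

lemma L2_integrable:
  fixes f :: "real \<Rightarrow> 'b::{banach, second_countable_topology}"
  assumes "f \<in> L2 T"
  shows "integrable (interval_measure T) f"
proof (rule Bochner_Integration.integrable_bound)
  show "integrable (interval_measure T) (\<lambda>t. 1 + (norm (f t))\<^sup>2)"
    using assms by (intro Bochner_Integration.integrable_add
        finite_measure.integrable_const[OF finite_measure_interval]) (simp add: L2_def)
  show "f \<in> borel_measurable (interval_measure T)"
    using assms by (auto simp: L2_def intro: strongly_measurable_imp_borel_measurable)
  have "x \<le> 1 + x\<^sup>2" for x :: real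
  proof -
    have "2 * x \<le> x\<^sup>2 + 1"
      using zero_le_power2[of "x - 1"] by (simp add: power2_diff)
    with zero_le_power2[of x] show ?thesis by linarith
  qed
  then show "AE t in interval_measure T. norm (f t) \<le> norm (1 + (norm (f t))\<^sup>2)"
    by (simp add: abs_of_nonneg add_nonneg_nonneg)
qed

lemma integrable_continuous_times_L2:
  fixes f :: "real \<Rightarrow> 'b::{banach, second_countable_topology}"
  assumes c: "continuous_on UNIV c" and f: "f \<in> L2 T"
  shows "integrable (interval_measure T) (\<lambda>t. c t *\<^sub>R f t)"
proof -
  have "bounded (c ` {0..T})"
    by (intro compact_imp_bounded compact_continuous_image continuous_on_subset[OF c]) auto
  then obtain K where K: "\<And>t. t \<in> {0..T} \<Longrightarrow> \<bar>c t\<bar> \<le> K"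
    unfolding bounded_iff by (metis image_eqI real_norm_def)
  show ?thesis
  proof (rule Bochner_Integration.integrable_bound)
    show "integrable (interval_measure T) (\<lambda>t. K *\<^sub>R f t)"
      using L2_integrable[OF f] by simp
    show "(\<lambda>t. c t *\<^sub>R f t) \<in> borel_measurable (interval_measure T)"
      by (rule borel_measurable_scaleR[OF continuous_imp_measurable_lebesgue_on[OF c]
            borel_measurable_integrable[OF L2_integrable[OF f]]])
    show "AE t in interval_measure T. norm (c t *\<^sub>R f t) \<le> norm (K *\<^sub>R f t)"
    proof (rule AE_I2)
      fix t assume "t \<in> space (interval_measure T)"
      then have "\<bar>c t\<bar> \<le> \<bar>K\<bar>"
        using K[of t] by simp
      then show "norm (c t *\<^sub>R f t) \<le> norm (K *\<^sub>R f t)"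
        by (simp add: mult_right_mono)
    qed
  qed
qed

section \<open>Weak derivatives and the zero control\<close>

lemma H1_bounded_linear:
  assumes h: "bounded_linear h" and p: "p \<in> H1 T"
  shows "(\<lambda>t. h (p t)) \<in> H1 T"
proof -
  obtain g where g: "g \<in> L2 T" and deriv: "is_weak_deriv T p g" and p: "p \<in> L2 T"
    using p by (auto simp: H1_def)
  \<comment> \<open>Bounded linear maps commute with the integral, so composing a weak derivative
    with \<open>h\<close> gives a weak derivative of the composition.\<close>
  have commute: "(LINT t|interval_measure T. c t *\<^sub>R h (f t)) = h (LINT t|interval_measure T. c t *\<^sub>R f t)"
    if "continuous_on UNIV c" "f \<in> L2 T" for c f
    using integral_bounded_linear[OF h integrable_continuous_times_L2[OF that]]
    by (simp add: linear_simps[OF h])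
  have "is_weak_deriv T (\<lambda>t. h (p t)) (\<lambda>t. h (g t))"
    using deriv test_function_continuous
    by (auto simp: is_weak_deriv_def commute p g linear_simps[OF h])
  then show ?thesis
    using L2_bounded_linear[OF h p] L2_bounded_linear[OF h g] by (auto simp: H1_def)
qed

lemma is_weak_deriv_zero: "is_weak_deriv T (\<lambda>_. 0) (\<lambda>_. 0)"
  by (simp add: is_weak_deriv_def)

lemma H1_zero: "(\<lambda>_. 0) \<in> H1 T"
  using is_weak_deriv_zero L2_zero by (auto simp: H1_def)

lemma norm_H1_zero: "norm_H1 T (\<lambda>_. 0 :: real) = 0"
proof -
  define g :: "real \<Rightarrow> real" where "g = weak_deriv T (\<lambda>_. 0)"
  have "g \<in> L2 T \<and> is_weak_deriv T (\<lambda>_. 0) g"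
    unfolding g_def weak_deriv_def by (rule someI[of _ "\<lambda>_. 0"]) (simp add: L2_zero is_weak_deriv_zero)
  \<comment> \<open>For the zero function, the defining identity of a weak derivative says that
    \<open>g\<close> integrates to zero against every test function.\<close>
  then have "AE t in interval_measure T. g t = 0"
    by (intro AE_eq_0_if_test_integrals_eq_0) (auto simp: is_weak_deriv_def L2_integrable)
  then have "norm_L2 T g = 0"
    by (auto simp: norm_L2_def intro!: integral_eq_zero_AE)
  then show ?thesis
    by (simp add: norm_H1_def g_def[symmetric]) (simp add: norm_L2_def)
qed

lemma zero_admissible:
  assumes "C > 0"
  shows "((\<lambda>_. 0), (\<lambda>_. 0), 0) \<in> admissible T C"
  using assms by (auto simp: admissible_def Z_def L2_zero H1_zero norm_H1_zero) (auto simp: norm_L2_def)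

section \<open>Almost everywhere convergent subsequences and Fatou's lemma\<close>

lemma L2_AE_convergent_subseq:
  assumes f: "\<And>k. f k \<in> L2 T" "g \<in> L2 T" and lim: "(\<lambda>k. norm_L2 T (\<lambda>t. f k t - g t)) \<longlonglongrightarrow> 0"
  obtains r where "strict_mono r" "AE t in interval_measure T. (\<lambda>k. f (r k) t) \<longlonglongrightarrow> g t"
proof -
  \<comment> \<open>Convergence in \<open>L2\<close> is convergence in mean of the squared
    distances, which yields an almost everywhere convergent subsequence; a square root undoes the
    squaring.\<close>
  have "(\<lambda>k. (norm_L2 T (\<lambda>t. f k t - g t))\<^sup>2) \<longlonglongrightarrow> 0"
    using tendsto_power[OF lim, of 2] by simp
  then have "\<exists>r. strict_mono r \<and>
      (AE t in interval_measure T. (\<lambda>k. (norm (f (r k) t - g t))\<^sup>2) \<longlonglongrightarrow> 0)"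
    using L2_diff[OF f] by (intro tendsto_L1_AE_subseq) (auto simp: norm_L2_squared L2_def)
  then obtain r where r: "strict_mono r"
      "AE t in interval_measure T. (\<lambda>k. (norm (f (r k) t - g t))\<^sup>2) \<longlonglongrightarrow> 0" by blast
  have "AE t in interval_measure T. (\<lambda>k. f (r k) t) \<longlonglongrightarrow> g t"
    using r(2)
  proof eventually_elim
    case (elim t)
    from tendsto_real_sqrt[OF this] show ?case
      by (simp add: tendsto_norm_zero_iff LIM_zero_iff)
  qed
  with r(1) show ?thesis by (rule that)
qed

lemma norm_L2_le_if_AE_limit:
  assumes f: "\<And>k. f k \<in> L2 T" and g: "g \<in> L2 T"
    and lim: "AE t in interval_measure T. (\<lambda>k. f k t) \<longlonglongrightarrow> g t"
    and bound: "\<And>k. (norm_L2 T (f k))\<^sup>2 \<le> c"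
  shows "(norm_L2 T g)\<^sup>2 \<le> c"
proof -
  let ?M = "interval_measure T"
  have nn: "(\<integral>\<^sup>+t. ennreal ((norm (h t))\<^sup>2) \<partial>?M) = ennreal ((norm_L2 T h)\<^sup>2)" if "h \<in> L2 T" for h :: "real \<Rightarrow> 'a"
    using that unfolding norm_L2_squared by (intro nn_integral_eq_integral) (auto simp: L2_def)
  have "ennreal ((norm_L2 T g)\<^sup>2) = (\<integral>\<^sup>+t. ennreal ((norm (g t))\<^sup>2) \<partial>?M)"
    by (rule nn[OF g, symmetric])
  also have "\<dots> = (\<integral>\<^sup>+t. liminf (\<lambda>k. ennreal ((norm (f k t))\<^sup>2)) \<partial>?M)"
  proof (rule nn_integral_cong_AE)
    show "AE t in ?M. ennreal ((norm (g t))\<^sup>2) = liminf (\<lambda>k. ennreal ((norm (f k t))\<^sup>2))"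
      using lim
    proof eventually_elim
      case (elim t)
      then have "(\<lambda>k. ennreal ((norm (f k t))\<^sup>2)) \<longlonglongrightarrow> ennreal ((norm (g t))\<^sup>2)"
        by (intro tendsto_ennrealI tendsto_power tendsto_norm)
      then show ?case by (rule lim_imp_Liminf[OF sequentially_bot, symmetric])
    qed
  qed
  also have "\<dots> \<le> liminf (\<lambda>k. \<integral>\<^sup>+t. ennreal ((norm (f k t))\<^sup>2) \<partial>?M)"
    using f by (intro nn_integral_liminf) (auto simp: L2_def)
  also have "\<dots> \<le> ennreal c"
    by (rule Liminf_le) (simp_all add: nn[OF f] ennreal_leI bound)
  \<comment> \<open>The instance of \<open>bound\<close> at index 0 shows \<open>0 \<le> c\<close>,
    so the inequality descends from \<open>ennreal\<close> to the reals.\<close>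
  finally show ?thesis
    using bound[of 0] by (simp add: order_trans[OF zero_le_power2])
qed

subsection \<open>Minimizers\<close>

lemma norm_L2_fst_le_norm_Z: "norm_L2 T \<alpha> \<le> norm_Z T (\<alpha>, p, \<phi>)"
  by (auto intro!: real_le_rsqrt)

text \<open>Only the function part of the \<open>H1\<close> norm is kept: it controls the almost
  everywhere convergence of the parameters \<open>p\<close>.\<close>

lemma norm_L2_snd_le_norm_Z: "norm_L2 T p \<le> norm_Z T (\<alpha>, p, \<phi>)"
  by (auto intro!: real_le_rsqrt simp: norm_H1_def)

lemma norm_le_norm_Z: "norm \<phi> \<le> norm_Z T (\<alpha>, p, \<phi>)"
  by (auto intro!: real_le_rsqrt)

lemma dist_Z_triple:
  "dist_Z T (\<alpha>, p, \<phi>) (\<beta>, q, \<psi>) = norm_Z T (\<lambda>t. \<alpha> t - \<beta> t, \<lambda>t. p t - q t, \<phi> - \<psi>)"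
  by (simp add: dist_Z_def)

lemma continuous_on_Z_tendsto:
  assumes "continuous_on_Z T F" "\<And>k. w k \<in> Z T" "u \<in> Z T" "(\<lambda>k. dist_Z T (w k) u) \<longlonglongrightarrow> 0"
  shows "(\<lambda>k. F (w k)) \<longlonglongrightarrow> F u"
proof (rule metric_LIMSEQ_I)
  fix e :: real assume "e > 0"
  then obtain d where d: "d > 0" "\<And>v. v \<in> Z T \<Longrightarrow> dist_Z T v u < d \<Longrightarrow> \<bar>F v - F u\<bar> < e"
    using assms(1,3) unfolding continuous_on_Z_def by blast
  obtain N where "\<And>k. k \<ge> N \<Longrightarrow> dist_Z T (w k) u < d"
    using order_tendstoD(2)[OF assms(4) d(1)] by (auto simp: eventually_sequentially)
  then show "\<exists>N. \<forall>k\<ge>N. dist (F (w k)) (F u) < e"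
    using d(2) assms(2) unfolding dist_real_def by blast
qed

text \<open>
  Along an almost everywhere convergent subsequence of the controls the residuals converge
  pointwise, because for fixed \<open>t\<close> the operators \<open>\<T> i (p k t) \<circ> \<iota>\<close> converge pointwise on the
  Banach space \<open>'y\<close>, hence along convergent arguments by Banach-Steinhaus. Fatou's lemma does the
  rest.
\<close>

lemma cost_lower_semicontinuous:
  fixes \<iota> :: "'y::banach \<Rightarrow> 'x::real_inner"
    and \<T> :: "'r::finite \<Rightarrow> real \<Rightarrow> 'x \<Rightarrow>\<^sub>L 'x"
  assumes \<iota>: "bounded_linear \<iota>"
    and z: "z \<in> L2 T"
    and cont: "\<And>i \<phi>. continuous_on UNIV (\<lambda>p. blinfun_apply (\<T> i p) (\<iota> \<phi>))"
    and L2: "\<And>i (\<alpha> :: real \<Rightarrow> real) (p :: real \<Rightarrow> real) \<phi>. \<alpha> \<in> L2 T \<Longrightarrow> p \<in> H1 T \<Longrightarrow>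
               (\<lambda>t. \<alpha> t *\<^sub>R blinfun_apply (\<T> i (p t)) (\<iota> \<phi>)) \<in> L2 T"
    and w: "\<And>k. w k \<in> Z T" and u: "u \<in> Z T" and lim: "(\<lambda>k. dist_Z T (w k) u) \<longlonglongrightarrow> 0"
    and bound: "\<And>k. cost T \<iota> \<T> z (w k) \<le> c"
  shows "cost T \<iota> \<T> z u \<le> c"
proof -
  define a p \<phi> where apf: "a = (\<lambda>k. fst (w k))" "p = (\<lambda>k. fst (snd (w k)))" "\<phi> = (\<lambda>k. snd (snd (w k)))"
  have wk: "w k = (a k, p k, \<phi> k)" for k by (simp add: apf)
  obtain b q \<psi> where u_eq: "u = (b, q, \<psi>)" by (cases u)
  have a: "a k \<in> L2 T" and p: "p k \<in> H1 T" for k using w[of k] by (auto simp: wk Z_def)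
  have b: "b \<in> L2 T" and q: "q \<in> H1 T" using u by (auto simp: u_eq Z_def)
  define res :: "(real \<Rightarrow> real ^ 'r) \<Rightarrow> (real \<Rightarrow> real ^ 'r) \<Rightarrow> 'y ^ 'r \<Rightarrow> real \<Rightarrow> 'x" where
    "res = (\<lambda>\<alpha> p \<phi> t. z t - (\<Sum>i\<in>UNIV. \<alpha> t $ i *\<^sub>R blinfun_apply (\<T> i (p t $ i)) (\<iota> (\<phi> $ i))))"
  have cost_eq: "cost T \<iota> \<T> z (\<alpha>, p, \<phi>) = (norm_L2 T (res \<alpha> p \<phi>))\<^sup>2 / 2" for \<alpha> p \<phi>
    by (simp add: res_def)
  \<comment> \<open>Coordinate projections are bounded linear, so the components of a control are
    scalar functions to which the hypothesis \<open>L2\<close> applies.\<close>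
  have res_L2: "res \<alpha> p \<phi> \<in> L2 T" if "\<alpha> \<in> L2 T" "p \<in> H1 T" for \<alpha> p \<phi>
    unfolding res_def
    by (intro L2_diff L2_sum z L2 L2_bounded_linear[OF bounded_linear_vec_nth]
        H1_bounded_linear[OF bounded_linear_vec_nth] that) simp
  have le_dist: "norm_L2 T (\<lambda>t. a k t - b t) \<le> dist_Z T (w k) u"
      "norm_L2 T (\<lambda>t. p k t - q t) \<le> dist_Z T (w k) u" "norm (\<phi> k - \<psi>) \<le> dist_Z T (w k) u" for k
    unfolding wk u_eq dist_Z_triple by (rule norm_L2_fst_le_norm_Z norm_L2_snd_le_norm_Z norm_le_norm_Z)+
  have "(\<lambda>k. norm_L2 T (\<lambda>t. a k t - b t)) \<longlonglongrightarrow> 0"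
    by (rule tendsto_sandwich[OF _ _ tendsto_const lim]) (auto simp: norm_L2_nonneg le_dist)
  then obtain r1 where r1: "strict_mono r1"
      "AE t in interval_measure T. (\<lambda>k. a (r1 k) t) \<longlonglongrightarrow> b t"
    using L2_AE_convergent_subseq a b by blast
  have "(\<lambda>k. norm_L2 T (\<lambda>t. p k t - q t)) \<longlonglongrightarrow> 0"
    by (rule tendsto_sandwich[OF _ _ tendsto_const lim]) (auto simp: norm_L2_nonneg le_dist)
  \<comment> \<open>The second extraction starts from the first subsequence, so that both functions
    converge along \<open>r1 \<circ> r2\<close>.\<close>
  then have p_r1: "(\<lambda>k. norm_L2 T (\<lambda>t. p (r1 k) t - q t)) \<longlonglongrightarrow> 0"
    using LIMSEQ_subseq_LIMSEQ r1(1) unfolding comp_def by fast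
  have p_q_L2: "p (r1 k) \<in> L2 T" "q \<in> L2 T" for k using p q by (auto simp: H1_def)
  obtain r2 where r2: "strict_mono r2"
      "AE t in interval_measure T. (\<lambda>k. p (r1 (r2 k)) t) \<longlonglongrightarrow> q t"
    by (rule L2_AE_convergent_subseq[OF p_q_L2 p_r1])
  define r where "r = r1 \<circ> r2"
  have r: "strict_mono r" using r1 r2 by (simp add: r_def strict_mono_o)
  have "(\<lambda>k. \<phi> k - \<psi>) \<longlonglongrightarrow> 0"
    by (rule Lim_null_comparison[OF _ lim]) (simp add: le_dist)
  then have "(\<lambda>k. \<phi> (r k)) \<longlonglongrightarrow> \<psi>"
    using LIMSEQ_subseq_LIMSEQ[OF _ r] by (auto simp: comp_def LIM_zero_iff)
  then have \<phi>_lim: "(\<lambda>k. \<phi> (r k) $ i) \<longlonglongrightarrow> \<psi> $ i" for i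
    by (rule tendsto_vec_nth)
  have "AE t in interval_measure T.
      (\<lambda>k. res (a (r k)) (p (r k)) (\<phi> (r k)) t) \<longlonglongrightarrow> res b q \<psi> t"
    using r1(2) r2(2)
  proof eventually_elim
    case (elim t)
    have "(\<lambda>k. a (r k) t) \<longlonglongrightarrow> b t"
      using LIMSEQ_subseq_LIMSEQ[OF elim(1) r2(1)] by (simp add: r_def comp_def)
    then have a_lim: "(\<lambda>k. a (r k) t $ i) \<longlonglongrightarrow> b t $ i" for i
      by (rule tendsto_vec_nth)
    have p_lim: "(\<lambda>k. p (r k) t $ i) \<longlonglongrightarrow> q t $ i" for i
      using elim(2) by (intro tendsto_vec_nth) (simp add: r_def)
    have "(\<lambda>k. blinfun_apply (\<T> i (p (r k) t $ i)) (\<iota> (\<phi> (r k) $ i))) \<longlonglongrightarrow>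
        blinfun_apply (\<T> i (q t $ i)) (\<iota> (\<psi> $ i))" for i
    proof (rule tendsto_pointwise_convergent_operators[OF _ _ \<phi>_lim])
      show "bounded_linear (\<lambda>y. blinfun_apply (\<T> i (p (r k) t $ i)) (\<iota> y))" for k
        by (rule bounded_linear_compose[OF blinfun.bounded_linear_right \<iota>])
      show "(\<lambda>k. blinfun_apply (\<T> i (p (r k) t $ i)) (\<iota> y)) \<longlonglongrightarrow>
          blinfun_apply (\<T> i (q t $ i)) (\<iota> y)" for y
        by (rule continuous_on_tendsto_compose[OF cont p_lim]) auto
    qed
    then show ?case
      unfolding res_def by (intro tendsto_diff tendsto_const tendsto_sum tendsto_scaleR a_lim)
  qed
  \<comment> \<open>The constant doubles because the cost carries the factor 1/2.\<close>
  then have "(norm_L2 T (res b q \<psi>))\<^sup>2 \<le> 2 * c"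
  proof (rule norm_L2_le_if_AE_limit[rotated 2])
    show "(norm_L2 T (res (a (r k)) (p (r k)) (\<phi> (r k))))\<^sup>2 \<le> 2 * c" for k
      using bound[of "r k"] unfolding wk cost_eq by simp
  qed (auto intro: res_L2 a p b q)
  then show ?thesis unfolding u_eq cost_eq by simp
qed

theorem theorem5:
  fixes T C :: real
    and \<iota> :: "'y::banach \<Rightarrow> 'x::{real_inner, complete_space}"
    and z :: "real \<Rightarrow> 'y"
    and \<T> :: "'r::finite \<Rightarrow> real \<Rightarrow> 'x \<Rightarrow>\<^sub>L 'x"
    and \<Lambda> :: "('r, 'y) control \<Rightarrow> real"
    and lam :: "nat \<Rightarrow> real"
    and w :: "nat \<Rightarrow> ('r, 'y) control"
    and u :: "('r, 'y) control"
    and s :: "nat \<Rightarrow> nat"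
  assumes T_pos: "T > 0"
    and Y_reflexive: "reflexive_space TYPE('y)"
    and Y_compact: "compact_embedding \<iota>"
    and Y_dense: "closure (range \<iota>) = UNIV"
    and z_L2: "z \<in> L2 T"
    and A1_inv: "\<And>i p. blinfun_apply (\<T> i p) ` range \<iota> \<subseteq> range \<iota>"
    and A1_cont: "\<And>i \<phi>. continuous_on UNIV (\<lambda>p. blinfun_apply (\<T> i p) (\<iota> \<phi>))"
    and A2: "\<And>i (\<alpha> :: real \<Rightarrow> real) (p :: real \<Rightarrow> real) \<phi>. \<alpha> \<in> L2 T \<Longrightarrow> p \<in> H1 T \<Longrightarrow>
               (\<lambda>t. \<alpha> t *\<^sub>R blinfun_apply (\<T> i (p t)) (\<iota> \<phi>)) \<in> L2 T"
    and C_pos: "C > 0"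
    and penalty: "penalty_functional T C \<Lambda>"
    and weights_mono: "mono lam"
    and weights_pos: "\<And>k. lam k > 0"
    and weights_lim: "filterlim lam at_top sequentially"
    and w_sol: "\<And>k. is_arg_min (\<lambda>u. cost T \<iota> \<T> (\<lambda>t. \<iota> (z t)) u + lam k * \<Lambda> u)
                                   (\<lambda>u. u \<in> Z T) (w k)"
    and u_in: "u \<in> Z T"
    and s_mono: "strict_mono s"
    and u_lim: "(\<lambda>k. dist_Z T (w (s k)) u) \<longlonglongrightarrow> 0"
  shows "is_arg_min (cost T \<iota> \<T> (\<lambda>t. \<iota> (z t))) (\<lambda>v. v \<in> admissible T C) u"
proof -
  let ?J = "cost T \<iota> \<T> (\<lambda>t. \<iota> (z t))"
  have J_nonneg: "0 \<le> ?J v" for v by (cases v) simp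
  have \<Lambda>_cont: "continuous_on_Z T \<Lambda>" and \<Lambda>_nonneg: "\<And>v. v \<in> Z T \<Longrightarrow> 0 \<le> \<Lambda> v"
    and \<Lambda>_zero: "\<And>v. v \<in> Z T \<Longrightarrow> \<Lambda> v = 0 \<longleftrightarrow> v \<in> admissible T C"
    using penalty by (auto simp: penalty_functional_def)
  have adm_Z: "v \<in> Z T" if "v \<in> admissible T C" for v :: "('r, 'y) control"
    using that by (auto simp: admissible_def)
  have w_Z: "w k \<in> Z T" for k
    using w_sol[of k] by (simp add: is_arg_min_def)
  have w_le: "?J (w k) + lam k * \<Lambda> (w k) \<le> ?J v" if "v \<in> admissible T C" for k v
  proof -
    have "?J (w k) + lam k * \<Lambda> (w k) \<le> ?J v + lam k * \<Lambda> v"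
      using w_sol[of k] adm_Z[OF that] unfolding is_arg_min_linorder by blast
    then show ?thesis
      using \<Lambda>_zero[OF adm_Z[OF that]] that by (simp del: cost.simps)
  qed
  \<comment> \<open>Dropping the nonnegative penalty leaves a bound on the cost alone that is
    uniform in \<open>k\<close>, hence valid along \<open>s\<close>.\<close>
  have J_w_le: "?J (w k) \<le> ?J v" if "v \<in> admissible T C" for k v
    using w_le[OF that, of k] mult_nonneg_nonneg[OF less_imp_le[OF weights_pos] \<Lambda>_nonneg[OF w_Z], of k k]
    by linarith
  have \<iota>: "bounded_linear \<iota>"
    using Y_compact by (simp add: compact_embedding_def)
  have "\<Lambda> u = 0"
  proof -
    let ?c = "?J ((\<lambda>_. 0), (\<lambda>_. 0), 0)"
    have "(\<lambda>k. \<Lambda> (w k)) \<longlonglongrightarrow> 0"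
    proof (rule tendsto_sandwich)
      show "\<forall>\<^sub>F k in sequentially. 0 \<le> \<Lambda> (w k)"
        by (simp add: \<Lambda>_nonneg w_Z)
      have "\<Lambda> (w k) \<le> ?c / lam k" for k
        using w_le[OF zero_admissible[OF C_pos], of k] J_nonneg[of "w k"] weights_pos[of k]
        by (simp add: pos_le_divide_eq mult.commute del: cost.simps)
      then show "\<forall>\<^sub>F k in sequentially. \<Lambda> (w k) \<le> ?c / lam k" by simp
      show "(\<lambda>k. ?c / lam k) \<longlonglongrightarrow> 0"
        by (rule real_tendsto_divide_at_top[OF tendsto_const weights_lim])
    qed simp
    from LIMSEQ_subseq_LIMSEQ[OF this s_mono] have "(\<lambda>k. \<Lambda> (w (s k))) \<longlonglongrightarrow> 0"
      by (simp add: comp_def)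
    moreover have "(\<lambda>k. \<Lambda> (w (s k))) \<longlonglongrightarrow> \<Lambda> u"
      by (rule continuous_on_Z_tendsto[OF \<Lambda>_cont w_Z u_in u_lim])
    ultimately show ?thesis by (rule LIMSEQ_unique[symmetric])
  qed
  then have "u \<in> admissible T C" using \<Lambda>_zero u_in by simp
  moreover have "?J u \<le> ?J v" if "v \<in> admissible T C" for v
    using cost_lower_semicontinuous[OF \<iota> L2_bounded_linear[OF \<iota> z_L2] A1_cont A2 w_Z u_in u_lim
        J_w_le[OF that]] .
  ultimately show ?thesis unfolding is_arg_min_linorder by blast
qed

end
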